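(* Let $n\ge 1$, let $a_1,\ldots,a_n>0$ and $k>0$ be fixed, and let $h(\boldsymbol{x},z)=z^2-\sum_{i=1}^n\frac{x_i^2}{a_i^2}$. Put $$C_0(t)=\frac{\pi^{n/2}}{\Gamma(n/2+1)}\,\frac{t^{n+1}}{n+1},\qquad C(t)=a_1\cdots a_n\,C_0(t)\qquad(t\ge0).$$ Every hyperplane tangent to the upper sheet of the two-sheeted hyperboloid $h(\boldsymbol{x},z)=k^2$ cuts off from the cone $\mathcal{C}=\{(\boldsymbol{x},z): z\ge 0,\ h(\boldsymbol{x},z)\ge 0\}$ an $(n+1)$-dimensional compact set of constant Euclidean volume $C(k)$. Conversely, let $V>0$. The $C^{2}$-surface which envelopes the family of the hyperplanes $z=\sum_{i=1}^n\lambda_ix_i+d$ satisfying $1-\sum_{i=1}^na_i^2\lambda_i^2>0$ and $d\ge 0$ and cutting off from the cone $\mathcal{C}$ a compact set of constant volume $V$ is the upper sheet of the two-sheeted hyperboloid $h(\boldsymbol{x},z)=k^2$, where $k=C^{-1}(V)$ ($k>0$).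
   Context: Points of the Euclidean space $E^{n+1}$ are written $(\boldsymbol{x},z)=(x_1,\ldots,x_n,z)$. The upper sheet of $h=k^2$ is its part in $\{z>0\}$. The set cut off from the cone $\mathcal{C}$ by the hyperplane $z=\sum_{i=1}^n\lambda_ix_i+d$ is $\{(\boldsymbol{x},z)\in\mathcal{C}: z\le\sum_{i=1}^n\lambda_ix_i+d\}$. The envelope of an $n$-parameter family of hyperplanes $\phi(\boldsymbol{x},z,\lambda_1,\ldots,\lambda_n)=0$ is the surface obtained by eliminating the parameters from $\phi=0$ and $\partial\phi/\partial\lambda_i=0$ ($i=1,\ldots,n$), i.e. the set of points $(\boldsymbol{x},z)$ for which some admissible parameter $(\lambda_1,\ldots,\lambda_n)$ satisfies all these equations; here the family is parametrized by the slopes $(\lambda_1,\ldots,\lambda_n)$. *)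

theory Defs
  imports "HOL-Analysis.Analysis"
begin

text \<open>
  The space $E^{n+1}$ is \<^typ>\<open>(real ^ 'n) \<times> real\<close> with $n$ = \<^term>\<open>CARD('n)\<close>; its library
  inner product, norm and Lebesgue measure are the Euclidean ones.
\<close>


subsection \<open>Tangent hyperplanes, $C^2$-hypersurfaces, envelopes\<close>

definition tangent_vectors :: "'a::euclidean_space set \<Rightarrow> 'a \<Rightarrow> 'a set" where
  "tangent_vectors S p =
     {v. \<exists>\<gamma> \<epsilon>. 0 < \<epsilon> \<and> \<gamma> C1_differentiable_on {-\<epsilon><..<\<epsilon>} \<and> \<gamma> ` {-\<epsilon><..<\<epsilon>} \<subseteq> S \<and>
              \<gamma> 0 = p \<and> (\<gamma> has_vector_derivative v) (at (0::real))}"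

definition is_hyperplane :: "'a::euclidean_space set \<Rightarrow> bool" where
  "is_hyperplane H \<longleftrightarrow> affine H \<and> aff_dim H = int (DIM('a)) - 1"

definition tangent_hyperplane :: "'a::euclidean_space set \<Rightarrow> 'a set \<Rightarrow> bool" where
  "tangent_hyperplane S H \<longleftrightarrow>
     is_hyperplane H \<and> (\<exists>p\<in>S. H = (\<lambda>v. p + v) ` tangent_vectors S p)"

text \<open>Here \<open>G\<close> is the gradient field of \<open>f\<close> and \<open>D\<close> the derivative (Hessian) of \<open>G\<close>.\<close>

definition C2_with_gradient ::
    "('a::euclidean_space \<Rightarrow> real) \<Rightarrow> ('a \<Rightarrow> 'a) \<Rightarrow> 'a set \<Rightarrow> bool" where
  "C2_with_gradient f G U \<longleftrightarrow>
     open U \<and> (\<forall>q\<in>U. (f has_derivative (\<lambda>v. G q \<bullet> v)) (at q)) \<and>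
     (\<exists>D :: 'a \<Rightarrow> 'a \<Rightarrow>\<^sub>L 'a.
        (\<forall>q\<in>U. (G has_derivative blinfun_apply (D q)) (at q)) \<and> continuous_on U D)"

definition C2_hypersurface :: "'a::euclidean_space set \<Rightarrow> bool" where
  "C2_hypersurface S \<longleftrightarrow>
     (\<forall>p\<in>S. \<exists>U f G. p \<in> U \<and> C2_with_gradient f G U \<and> (\<forall>q\<in>U. G q \<noteq> 0) \<and>
                    S \<inter> U = {q \<in> U. f q = 0})"

text \<open>
  The partial derivative with respect to the \<open>i\<close>-th parameter is taken along the \<open>i\<close>-th
  coordinate axis through \<open>m\<close>.
\<close>

definition envelope :: "(real ^ 'n) set \<Rightarrow> ('a \<Rightarrow> real ^ 'n \<Rightarrow> real) \<Rightarrow> 'a set" where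
  "envelope M \<phi> =
     {p. \<exists>m\<in>M. \<phi> p m = 0 \<and>
           (\<forall>i. ((\<lambda>s. \<phi> p (m + s *\<^sub>R axis i 1)) has_real_derivative 0) (at 0))}"


subsection \<open>The cone, the hyperboloid and the volume functions\<close>

definition h :: "real ^ 'n \<Rightarrow> (real ^ 'n) \<times> real \<Rightarrow> real" where
  "h a = (\<lambda>(x, z). z\<^sup>2 - (\<Sum>i\<in>UNIV. (x $ i)\<^sup>2 / (a $ i)\<^sup>2))"

definition upper_sheet :: "real ^ 'n \<Rightarrow> real \<Rightarrow> ((real ^ 'n) \<times> real) set" where
  "upper_sheet a k = {(x, z). h a (x, z) = k\<^sup>2 \<and> z > 0}"

definition cone_set :: "real ^ 'n \<Rightarrow> ((real ^ 'n) \<times> real) set" where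
  "cone_set a = {(x, z). z \<ge> 0 \<and> h a (x, z) \<ge> 0}"

definition graph_hyperplane :: "real ^ 'n \<Rightarrow> real \<Rightarrow> ((real ^ 'n) \<times> real) set" where
  "graph_hyperplane m d = {(x, z). z = (\<Sum>i\<in>UNIV. m $ i * x $ i) + d}"

definition cut_off :: "real ^ 'n \<Rightarrow> real ^ 'n \<Rightarrow> real \<Rightarrow> ((real ^ 'n) \<times> real) set" where
  "cut_off a m d = {(x, z). (x, z) \<in> cone_set a \<and> z \<le> (\<Sum>i\<in>UNIV. m $ i * x $ i) + d}"

definition C0 :: "nat \<Rightarrow> real \<Rightarrow> real" where
  "C0 n t = pi powr (real n / 2) / Gamma (real n / 2 + 1) * (t ^ (n + 1) / real (n + 1))"

definition C :: "real ^ 'n \<Rightarrow> real \<Rightarrow> real" where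
  "C a t = (\<Prod>i\<in>UNIV. a $ i) * C0 CARD('n) t"


subsection \<open>The family of hyperplanes cutting off constant volume\<close>

definition admissible_slopes :: "real ^ 'n \<Rightarrow> (real ^ 'n) set" where
  "admissible_slopes a = {m. 1 - (\<Sum>i\<in>UNIV. (a $ i)\<^sup>2 * (m $ i)\<^sup>2) > 0}"

definition cuts_volume :: "real ^ 'n \<Rightarrow> real \<Rightarrow> real ^ 'n \<Rightarrow> real \<Rightarrow> bool" where
  "cuts_volume a V m d \<longleftrightarrow>
     d \<ge> 0 \<and> compact (cut_off a m d) \<and> measure lebesgue (cut_off a m d) = V"

text \<open>
  The family is parametrized by the slope \<open>m\<close> alone: \<open>d\<close> is the function of \<open>m\<close> determined
  by the volume condition.
\<close>

definition intercept :: "real ^ 'n \<Rightarrow> real \<Rightarrow> real ^ 'n \<Rightarrow> real" where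
  "intercept a V m = (THE d. cuts_volume a V m d)"

definition family_eq :: "real ^ 'n \<Rightarrow> real \<Rightarrow> (real ^ 'n) \<times> real \<Rightarrow> real ^ 'n \<Rightarrow> real" where
  "family_eq a V = (\<lambda>(x, z) m. z - ((\<Sum>i\<in>UNIV. m $ i * x $ i) + intercept a V m))"

end

theory Submission
  imports Defs
begin

text \<open>
  The shear \<open>(x, z) \<mapsto> (x, z - m \<bullet> x)\<close> turns the set cut off by \<open>z = m \<bullet> x + d\<close> into one whose
  slices at height \<open>w \<in> [0, d]\<close> are the ellipsoids \<open>\<bar>x/a\<bar> \<le> w + m \<bullet> x\<close>. After the substitution
  \<open>x = a y\<close>, a rotation and a stretch along one axis these become balls of radius \<open>w / q\<close>, where
  \<open>q\<^sup>2 = 1 - \<Sum> a\<^sub>i\<^sup>2 m\<^sub>i\<^sup>2\<close>, so the cut-off volume is \<open>C (d / q)\<close>. Constant volume \<open>C r\<close> therefore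
  means \<open>d = r q\<close>, and both the tangent hyperplanes of the hyperboloid and the envelope are
  computed from this explicit intercept.
\<close>

section \<open>Lebesgue measure under rotations and diagonal stretches, and the volume of a tilted
  ball\<close>

text \<open>With \<open>B\<close> the unit ball, integrating \<open>1\<^sub>A (f x) 1\<^sub>B (f x - y)\<close> over \<open>x\<close> and \<open>y\<close> in both orders
  compares the two measures up to the finite positive factor \<open>vol B\<close>. The library's
  \<open>measure_orthogonal_image\<close> is restricted to well-ordered index types.\<close>

lemma emeasure_lborel_orthogonal_vimage:
  fixes f :: "'a::euclidean_space \<Rightarrow> 'a"
  assumes f: "orthogonal_transformation f" and A [measurable]: "A \<in> sets borel"
  shows "emeasure lborel (f -` A) = emeasure lborel A"
proof -
  have lin: "linear f" and nrm: "\<And>x. norm (f x) = norm x"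
    using f by (auto simp: orthogonal_transformation)
  have [measurable]: "f \<in> borel_measurable borel"
    using lin by (intro borel_measurable_continuous_onI linear_continuous_on linear_conv_bounded_linear[THEN iffD1])
  have vf: "f -` S \<in> sets borel" if "S \<in> sets borel" for S
    using measurable_sets[of f borel borel S] that by simp
  define B :: "'a set" where "B = cball 0 1"
  have [measurable]: "B \<in> sets borel" by (simp add: B_def)
  have 1: "(\<integral>\<^sup>+y. indicator A (f x) * indicator B (f x - y) \<partial>lborel)
      = indicator (f -` A) x * emeasure lborel B" for x
  proof -
    have "(\<integral>\<^sup>+y. indicator A (f x) * indicator B (f x - y) \<partial>lborel)
        = (\<integral>\<^sup>+y. indicator A (f x) * indicator (cball (f x) 1) y \<partial>lborel)"
      by (intro nn_integral_cong) (auto simp: B_def dist_norm norm_minus_commute split: split_indicator)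
    also have "\<dots> = indicator A (f x) * emeasure lborel (cball (f x) 1)"
      by (rule nn_integral_cmult_indicator) simp
    also have "\<dots> = indicator (f -` A) x * emeasure lborel B"
      by (auto simp: B_def emeasure_cball split: split_indicator)
    finally show ?thesis .
  qed
  \<comment> \<open>Translating \<open>x\<close> by a preimage \<open>c\<close> of \<open>y\<close>
    moves the shift from the argument of \<open>B\<close> to that of \<open>A\<close>.\<close>
  have 2: "(\<integral>\<^sup>+x. indicator A (f x) * indicator B (f x - y) \<partial>lborel)
      = (\<integral>\<^sup>+x. indicator A (f x + y) * indicator B (f x) \<partial>lborel)" for y
  proof -
    obtain c where c: "f c = y"
      using orthogonal_transformation_surj[OF f] by (metis surjD)
    have "(\<integral>\<^sup>+x. indicator A (f x) * indicator B (f x - y) \<partial>lborel)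
        = (\<integral>\<^sup>+x. indicator A (f x) * indicator B (f x - y) \<partial>(distr lborel borel ((+) c)))"
      by (simp add: lborel_distr_plus)
    also have "\<dots> = (\<integral>\<^sup>+x. indicator A (f (c + x)) * indicator B (f (c + x) - y) \<partial>lborel)"
      by (subst nn_integral_distr) auto
    also have "\<dots> = (\<integral>\<^sup>+x. indicator A (f x + y) * indicator B (f x) \<partial>lborel)"
      by (simp add: linear_add[OF lin] c add.commute)
    finally show ?thesis .
  qed
  \<comment> \<open>Integrating over \<open>y\<close> absorbs the shift \<open>f x\<close>, and
    \<open>f\<close> preserves the norm defining \<open>B\<close>, so \<open>f\<close>
    disappears.\<close>
  have 3: "(\<integral>\<^sup>+y. indicator A (f x + y) * indicator B (f x) \<partial>lborel)
      = emeasure lborel A * indicator B x" for x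
  proof -
    have "(\<integral>\<^sup>+y. indicator A (f x + y) * indicator B (f x) \<partial>lborel)
        = (\<integral>\<^sup>+y. indicator A (f x + y) \<partial>lborel) * indicator B (f x)"
      by (simp add: nn_integral_multc)
    also have "(\<integral>\<^sup>+y. indicator A (f x + y) \<partial>lborel)
        = (\<integral>\<^sup>+y. indicator A y \<partial>(distr lborel borel ((+) (f x))))"
      by (subst nn_integral_distr) auto
    also have "\<dots> = emeasure lborel A"
      by (simp add: lborel_distr_plus)
    finally show ?thesis
      by (simp add: B_def nrm indicator_def)
  qed
  have "emeasure lborel (f -` A) * emeasure lborel B
      = (\<integral>\<^sup>+x. \<integral>\<^sup>+y. indicator A (f x) * indicator B (f x - y) \<partial>lborel \<partial>lborel)"
    by (simp add: 1 vf nn_integral_multc)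
  also have "\<dots> = (\<integral>\<^sup>+y. \<integral>\<^sup>+x. indicator A (f x) * indicator B (f x - y) \<partial>lborel \<partial>lborel)"
    by (subst lborel_pair.Fubini') auto
  also have "\<dots> = (\<integral>\<^sup>+x. \<integral>\<^sup>+y. indicator A (f x + y) * indicator B (f x) \<partial>lborel \<partial>lborel)"
    unfolding 2 by (subst lborel_pair.Fubini') auto
  also have "\<dots> = emeasure lborel A * emeasure lborel B"
    by (simp add: 3 nn_integral_cmult)
  finally show ?thesis
    by (simp add: B_def emeasure_cball mult.commute[of _ "ennreal _"] ennreal_mult_cancel_left less_imp_neq[symmetric])
qed

lemma emeasure_lborel_stretch_vimage:
  fixes c :: "'n::finite \<Rightarrow> real" and t :: "real ^ 'n"
  assumes c: "\<And>i. c i > 0" and A: "A \<in> sets borel"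
  shows "emeasure lborel A = ennreal (\<Prod>i\<in>UNIV. c i) * emeasure lborel ((\<lambda>x. \<chi> i. t $ i + c i * x $ i) -` A)"
proof -
  \<comment> \<open>\<open>lborel_affine_euclidean\<close> takes its factors indexed by basis
    vectors; \<open>c'\<close> is the linear form with value \<open>c i\<close> at the i-th
    one.\<close>
  define c' where "c' j = (\<Sum>i\<in>UNIV. c i * j $ i)" for j :: "real ^ 'n"
  have c'_axis: "c' (axis i 1) = c i" for i
    by (simp add: c'_def axis_def if_distrib sum.delta cong: if_cong)
  have B: "(Basis :: (real ^ 'n) set) = (\<lambda>i. axis i 1) ` UNIV"
    by (auto simp: Basis_vec_def)
  have inj: "inj (\<lambda>i::'n. axis i (1::real))"
    by (auto simp: inj_def axis_eq_axis)
  have T: "t + (\<Sum>j\<in>Basis. (c' j * (x \<bullet> j)) *\<^sub>R j) = (\<chi> i. t $ i + c i * x $ i)" for x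
    unfolding B sum.reindex[OF inj] comp_def c'_axis inner_axis
    by (simp add: vec_eq_iff axis_def if_distrib sum.delta cong: if_cong)
  have "(lborel :: (real ^ 'n) measure) = density (distr lborel borel (\<lambda>x. t + (\<Sum>j\<in>Basis. (c' j * (x \<bullet> j)) *\<^sub>R j)))
      (\<lambda>_. (\<Prod>j\<in>Basis. \<bar>c' j\<bar>))"
    using c by (intro lborel_affine_euclidean) (auto simp: B c'_axis less_imp_neq[symmetric])
  also have "(\<Prod>j\<in>Basis. \<bar>c' j\<bar>) = (\<Prod>i\<in>UNIV. c i)"
    using c by (simp add: B prod.reindex[OF inj] c'_axis less_imp_le)
  finally have eq: "(lborel :: (real ^ 'n) measure)
      = density (distr lborel borel (\<lambda>x. \<chi> i. t $ i + c i * x $ i)) (\<lambda>_. (\<Prod>i\<in>UNIV. c i))"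
    unfolding T .
  have m: "(\<lambda>x. \<chi> i. t $ i + c i * x $ i) \<in> borel_measurable borel"
    by (intro borel_measurable_continuous_onI continuous_intros)
  show ?thesis
    by (subst eq) (use A m in \<open>simp add: emeasure_density nn_integral_cmult emeasure_distr\<close>)
qed

text \<open>For \<open>w > 0\<close> this is a solid ellipsoid with a focus at the origin and
  eccentricity \<open>norm b\<close>. Completing the square gives semi-axis
  \<open>w / q\<^sup>2\<close> along \<open>b\<close> and \<open>w / q\<close> across it, whence the
  power n + 1 of \<open>q\<close>.\<close>

lemma emeasure_tilted_ball:
  fixes b :: "real ^ 'n"
  assumes b: "norm b < 1" and w: "w \<ge> 0"
  shows "emeasure lborel {y. norm y \<le> w + b \<bullet> y}
    = ennreal (unit_ball_vol CARD('n) * w ^ CARD('n) / sqrt (1 - (norm b)\<^sup>2) ^ (CARD('n) + 1))"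
proof -
  define s where "s = norm b"
  define q where "q = sqrt (1 - s\<^sup>2)"
  \<comment> \<open>Which coordinate axis stands for the direction of \<open>b\<close> is
    immaterial.\<close>
  define k :: 'n where "k = undefined"
  have s: "0 \<le> s" "s < 1" using b by (auto simp: s_def)
  then have "s\<^sup>2 < 1" by (simp add: power_less_one_iff abs_square_less_1)
  then have q: "q > 0" and q2: "q\<^sup>2 = 1 - s\<^sup>2" by (auto simp: q_def)
  have "norm (axis k s) = norm b" using s by (simp add: s_def norm_eq_sqrt_inner inner_axis_axis)
  then obtain f :: "real ^ 'n \<Rightarrow> real ^ 'n" where f: "orthogonal_transformation f" and fb: "f (axis k s) = b"
    by (rule orthogonal_transformation_exists)
  define S where "S = {y. norm y \<le> w + b \<bullet> y}"
  define c where "c i = (if i = k then 1 / q else 1)" for i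
  define t :: "real ^ 'n" where "t = axis k (w * s / q\<^sup>2)"
  have cS: "closed S"
    unfolding S_def by (intro closed_Collect_le continuous_intros)
  have fS: "f -` S = {v. norm v \<le> w + s * v $ k}"
  proof -
    have "b \<bullet> f v = s * v $ k" for v
      using f fb by (metis orthogonal_transformation_def inner_axis' real_inner_1_right inner_real_def)
    then show ?thesis
      using f by (auto simp: S_def orthogonal_transformation)
  qed
  have cfS: "closed (f -` S)"
    unfolding fS by (intro closed_Collect_le continuous_intros)
  have TfS: "(\<lambda>x. \<chi> i. t $ i + c i * x $ i) -` (f -` S) = cball 0 (w / q)"
  proof -
    have "norm (\<chi> i. t $ i + c i * u $ i) \<le> w + s * (t $ k + c k * u $ k) \<longleftrightarrow> norm u \<le> w / q" for u
    proof -
      define U where "U = u $ k"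
      \<comment> \<open>\<open>R\<close> is the right-hand side \<open>w + s * v $ k\<close> at the
        image \<open>v\<close> of \<open>u\<close>. The aim is \<open>key\<close>: the defining
        inequality, squared, becomes that of the ball.\<close>
      define R where "R = w + s * (w * s / q\<^sup>2 + U / q)"
      have R: "R = (w + s * q * U) / q\<^sup>2"
      proof -
        have "R = (w * (q\<^sup>2 + s\<^sup>2) + s * q * U) / q\<^sup>2"
          using q by (simp add: R_def field_simps power2_eq_square)
        then show ?thesis by (simp add: q2)
      qed
      have nu: "(norm u)\<^sup>2 = U\<^sup>2 + (\<Sum>i\<in>UNIV - {k}. (u $ i)\<^sup>2)"
        by (simp add: norm_vec_def L2_set_def sum_nonneg U_def sum.remove[of UNIV k])
      have "(norm (\<chi> i. t $ i + c i * u $ i))\<^sup>2 = (\<Sum>i\<in>UNIV. (t $ i + c i * u $ i)\<^sup>2)"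
        by (simp add: norm_vec_def L2_set_def sum_nonneg)
      also have "\<dots> = (w * s / q\<^sup>2 + U / q)\<^sup>2 + (\<Sum>i\<in>UNIV - {k}. (t $ i + c i * u $ i)\<^sup>2)"
        by (simp add: sum.remove[of UNIV k] t_def c_def U_def)
      also have "(\<Sum>i\<in>UNIV - {k}. (t $ i + c i * u $ i)\<^sup>2) = (\<Sum>i\<in>UNIV - {k}. (u $ i)\<^sup>2)"
        by (intro sum.cong) (auto simp: t_def c_def axis_def)
      finally have "(norm (\<chi> i. t $ i + c i * u $ i))\<^sup>2 = (norm u)\<^sup>2 - U\<^sup>2 + (w * s / q\<^sup>2 + U / q)\<^sup>2"
        using nu by simp
      also have "w * s / q\<^sup>2 + U / q = (w * s + q * U) / q\<^sup>2"
        using q by (simp add: field_simps power2_eq_square)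
      finally have nT: "R\<^sup>2 - (norm (\<chi> i. t $ i + c i * u $ i))\<^sup>2
          = ((w + s * q * U)\<^sup>2 - (w * s + q * U)\<^sup>2) / (q\<^sup>2)\<^sup>2 + U\<^sup>2 - (norm u)\<^sup>2"
        by (simp add: R power_divide diff_divide_distrib)
      also have "(w + s * q * U)\<^sup>2 - (w * s + q * U)\<^sup>2 = (1 - s\<^sup>2) * (w\<^sup>2 - q\<^sup>2 * U\<^sup>2)"
        by algebra
      also have "\<dots> / (q\<^sup>2)\<^sup>2 + U\<^sup>2 = (w / q)\<^sup>2"
        unfolding q2[symmetric] using q by (simp add: field_simps power2_eq_square)
      finally have key: "R\<^sup>2 - (norm (\<chi> i. t $ i + c i * u $ i))\<^sup>2 = (w / q)\<^sup>2 - (norm u)\<^sup>2" .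
      \<comment> \<open>Passing from squares back to the inequality requires a nonnegative
        right-hand side.\<close>
      have Rnn: "R \<ge> 0" if "norm u \<le> w / q"
      proof -
        have "\<bar>U\<bar> \<le> w / q" using that component_le_norm_cart[of u k] by (simp add: U_def)
        then have "\<bar>s * (q * U)\<bar> \<le> 1 * w"
          unfolding abs_mult using s q by (intro mult_mono) (auto simp: field_simps)
        then show ?thesis unfolding R by (intro divide_nonneg_nonneg) (auto simp: mult.assoc)
      qed
      have "norm (\<chi> i. t $ i + c i * u $ i) \<le> R \<longleftrightarrow> norm u \<le> w / q"
      proof
        assume le: "norm (\<chi> i. t $ i + c i * u $ i) \<le> R"
        then have "(norm (\<chi> i. t $ i + c i * u $ i))\<^sup>2 \<le> R\<^sup>2" by (intro power_mono) auto
        then have "(norm u)\<^sup>2 \<le> (w / q)\<^sup>2" using key by simp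
        then show "norm u \<le> w / q" using w q by (auto intro: power2_le_imp_le)
      next
        assume le: "norm u \<le> w / q"
        then have "(norm u)\<^sup>2 \<le> (w / q)\<^sup>2" by (intro power_mono) auto
        then have "(norm (\<chi> i. t $ i + c i * u $ i))\<^sup>2 \<le> R\<^sup>2" using key by simp
        then show "norm (\<chi> i. t $ i + c i * u $ i) \<le> R" using Rnn[OF le] by (auto intro: power2_le_imp_le)
      qed
      then show ?thesis by (simp add: R_def t_def c_def U_def)
    qed
    then show ?thesis
      unfolding fS by (intro set_eqI) (simp only: vimage_eq mem_Collect_eq vec_lambda_beta mem_cball_0)
  qed
  have "emeasure lborel S = emeasure lborel (f -` S)"
    using cS f by (simp add: emeasure_lborel_orthogonal_vimage)
  also have "\<dots> = ennreal (\<Prod>i\<in>UNIV. c i) * emeasure lborel (cball (0 :: real ^ 'n) (w / q))"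
    using emeasure_lborel_stretch_vimage[of c "f -` S" t, unfolded TfS] cfS q by (simp add: c_def)
  also have "\<dots> = ennreal (unit_ball_vol CARD('n) * w ^ CARD('n) / q ^ (CARD('n) + 1))"
    using w q by (simp add: emeasure_cball c_def prod.delta ennreal_mult'[symmetric] field_simps power_divide)
  finally show ?thesis by (simp add: S_def q_def s_def)
qed

section \<open>Coordinates in which the cone is round\<close>

definition scaled :: "real ^ 'n \<Rightarrow> real ^ 'n \<Rightarrow> real ^ 'n" where
  "scaled a x = (\<chi> i. x $ i / a $ i)"

text \<open>The \<open>q\<close> of the proof idea. For admissible slopes it is the Lorentzian
  length of the normal \<open>(- b, 1)\<close>, where \<open>b\<close> has the components
  \<open>a $ i * m $ i\<close>.\<close>

definition slope_defect :: "real ^ 'n \<Rightarrow> real ^ 'n \<Rightarrow> real" where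
  "slope_defect a m = sqrt (1 - (\<Sum>i\<in>UNIV. (a $ i)\<^sup>2 * (m $ i)\<^sup>2))"

lemma norm_scaled_power2: "(norm (scaled a x))\<^sup>2 = (\<Sum>i\<in>UNIV. (x $ i)\<^sup>2 / (a $ i)\<^sup>2)"
  by (simp add: scaled_def norm_vec_def L2_set_def sum_nonneg power_divide)

lemma h_eq: "h a (x, z) = z\<^sup>2 - (norm (scaled a x))\<^sup>2"
  by (simp add: h_def norm_scaled_power2)

lemma cone_set_iff: "(x, z) \<in> cone_set a \<longleftrightarrow> norm (scaled a x) \<le> z"
proof
  assume "(x, z) \<in> cone_set a"
  then show "norm (scaled a x) \<le> z"
    by (auto simp: cone_set_def h_eq intro: power2_le_imp_le)
next
  assume le: "norm (scaled a x) \<le> z"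
  then have "z \<ge> 0" using norm_ge_zero order_trans by blast
  with le show "(x, z) \<in> cone_set a"
    by (auto simp: cone_set_def h_eq intro: power_mono)
qed

lemma cut_off_eq: "cut_off a m d = {(x, z). norm (scaled a x) \<le> z \<and> z \<le> m \<bullet> x + d}"
  by (auto simp: cut_off_def cone_set_iff inner_vec_def)

lemma C_eq: "C a t = (\<Prod>i\<in>UNIV. a $ i) * (unit_ball_vol CARD('n) * (t ^ (CARD('n) + 1) / (CARD('n) + 1)))"
  for a :: "real ^ 'n"
  by (simp add: C_def C0_def unit_ball_vol_def)

lemma graph_hyperplane_eq: "graph_hyperplane m d = {p. (- m, 1) \<bullet> p = d}"
  by (auto simp: graph_hyperplane_def inner_vec_def sum_negf)

lemma continuous_on_scaled [continuous_intros]: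
  "continuous_on S f \<Longrightarrow> continuous_on S (\<lambda>x. scaled a (f x))"
  unfolding scaled_def divide_inverse by (intro continuous_intros)

text \<open>A set of smaller affine dimension lies in a hyperplane, which is negligible. This will
  show that the cut-off sets are (n+1)-dimensional.\<close>

lemma aff_dim_measure_pos:
  fixes S :: "'a::euclidean_space set"
  assumes "measure lebesgue S > 0"
  shows "aff_dim S = int (DIM('a))"
proof (rule ccontr)
  assume "aff_dim S \<noteq> int (DIM('a))"
  then have "aff_dim S < int (DIM('a))"
    using aff_dim_le_DIM[of S] by simp
  then obtain u c where "u \<noteq> 0" "S \<subseteq> {x. u \<bullet> x = c}"
    by (rule aff_lowdim_subset_hyperplane)
  then have "negligible S"
    using negligible_hyperplane[of u c] by (blast intro: negligible_subset)
  with assms show False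
    by (simp add: negligible_imp_measure0)
qed

section \<open>Smoothness and tangent vectors of the hyperboloid\<close>

definition grad_h :: "real ^ 'n \<Rightarrow> (real ^ 'n) \<times> real \<Rightarrow> (real ^ 'n) \<times> real" where
  "grad_h a p = (\<chi> i. - 2 * fst p $ i / (a $ i)\<^sup>2, 2 * snd p)"

lemma h_has_derivative:
  fixes a :: "real ^ 'n"
  shows "(h a has_derivative (\<lambda>v. grad_h a p \<bullet> v)) (at p)"
proof -
  define c where "c i = 1 / (a $ i)\<^sup>2" for i
  have eq: "h a = (\<lambda>p. (snd p)\<^sup>2 - (\<Sum>i\<in>UNIV. c i * (fst p $ i)\<^sup>2))"
    by (auto simp: h_def c_def fun_eq_iff)
  have nth: "((\<lambda>p. fst p $ i) has_derivative (\<lambda>v. fst v $ i)) (at p)" for i and p :: "(real ^ 'n) \<times> real"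
    by (intro bounded_linear.has_derivative[OF bounded_linear_vec_nth] derivative_intros)
  have "((\<lambda>p. (snd p)\<^sup>2 - (\<Sum>i\<in>UNIV. c i * (fst p $ i)\<^sup>2)) has_derivative
      (\<lambda>v. 2 * snd p * snd v - (\<Sum>i\<in>UNIV. c i * (2 * fst p $ i * fst v $ i)))) (at p)"
    by (auto intro!: derivative_eq_intros nth simp: mult_ac)
  also have "(\<lambda>v. 2 * snd p * snd v - (\<Sum>i\<in>UNIV. c i * (2 * fst p $ i * fst v $ i))) = (\<lambda>v. grad_h a p \<bullet> v)"
    by (auto simp: fun_eq_iff grad_h_def c_def inner_prod_def inner_vec_def sum_negf)
  finally show ?thesis unfolding eq .
qed

lemma bounded_linear_grad_h: "bounded_linear (grad_h a)"
proof -
  have "linear (grad_h a)"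
    by (rule linearI) (auto simp: grad_h_def vec_eq_iff add_divide_distrib diff_divide_distrib algebra_simps)
  then show ?thesis by (simp add: linear_conv_bounded_linear)
qed

text \<open>One defining function serves all points: on the open half-space \<open>z > 0\<close> the
  zero set of \<open>h a - r\<^sup>2\<close> is the sheet, and the last gradient component
  \<open>2 * z\<close> does not vanish.\<close>

lemma C2_upper_sheet:
  fixes a :: "real ^ 'n"
  shows "C2_hypersurface (upper_sheet a r)"
  unfolding C2_hypersurface_def
proof
  fix p assume p: "p \<in> upper_sheet a r"
  define U where "U = {p :: (real ^ 'n) \<times> real. 0 < snd p}"
  have "C2_with_gradient (\<lambda>p. h a p - r\<^sup>2) (grad_h a) U"
    unfolding C2_with_gradient_def
  proof (intro conjI ballI exI)
    show "open U" unfolding U_def by (intro open_Collect_less continuous_intros)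
    show "((\<lambda>p. h a p - r\<^sup>2) has_derivative (\<lambda>v. grad_h a q \<bullet> v)) (at q)" for q
      using has_derivative_diff[OF h_has_derivative has_derivative_const] by simp
    \<comment> \<open>\<open>h a\<close> is quadratic, so its gradient is linear and its Hessian
      constant.\<close>
    show "(grad_h a has_derivative blinfun_apply (Blinfun (grad_h a))) (at q)" for q
      unfolding bounded_linear_Blinfun_apply[OF bounded_linear_grad_h]
      by (rule bounded_linear_imp_has_derivative[OF bounded_linear_grad_h])
  qed (rule continuous_on_const)
  moreover have "grad_h a q \<noteq> 0" if "q \<in> U" for q
    using that by (auto simp: U_def grad_h_def zero_prod_def)
  moreover have "upper_sheet a r \<inter> U = {q \<in> U. h a q - r\<^sup>2 = 0}" "p \<in> U"
    using p by (auto simp: upper_sheet_def U_def)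
  ultimately show "\<exists>U f G. p \<in> U \<and> C2_with_gradient f G U \<and> (\<forall>q\<in>U. G q \<noteq> 0) \<and>
      upper_sheet a r \<inter> U = {q \<in> U. f q = 0}"
    by blast
qed

text \<open>\<open>h a\<close> is constant along a curve in the sheet, so the chain rule gives
  derivative zero. Only this inclusion is shown; for tangent hyperplanes a dimension count supplies
  equality.\<close>

lemma tangent_vectors_upper_sheet:
  assumes "v \<in> tangent_vectors (upper_sheet a k) p"
  shows "grad_h a p \<bullet> v = 0"
proof -
  obtain \<gamma> e where e: "e > 0" and sub: "\<gamma> ` {-e<..<e} \<subseteq> upper_sheet a k" and "\<gamma> 0 = p"
    and D: "(\<gamma> has_vector_derivative v) (at (0::real))"
    using assms by (auto simp: tangent_vectors_def)
  have "((\<lambda>s. h a (\<gamma> s)) has_derivative (\<lambda>s. grad_h a (\<gamma> 0) \<bullet> (s *\<^sub>R v))) (at 0)"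
    using D unfolding has_vector_derivative_def
    by (rule has_derivative_compose[OF _ h_has_derivative])
  moreover have "((\<lambda>s. h a (\<gamma> s)) has_derivative (\<lambda>s. 0)) (at 0)"
  proof (rule has_derivative_transform_within_open[OF has_derivative_const[of "k\<^sup>2"]])
    show "open {-e<..<e}" "0 \<in> {-e<..<e}" using e by auto
    show "k\<^sup>2 = h a (\<gamma> s)" if "s \<in> {-e<..<e}" for s
      using sub that by (cases "\<gamma> s") (force simp: upper_sheet_def image_subset_iff)
  qed
  ultimately have "(\<lambda>s. grad_h a (\<gamma> 0) \<bullet> (s *\<^sub>R v)) = (\<lambda>s. 0)"
    by (rule has_derivative_unique)
  from fun_cong[OF this, of 1] show ?thesis using \<open>\<gamma> 0 = p\<close> by simp
qed

section \<open>Compactness and volume of the cut-off sets\<close>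

lemma slope_defect_pos: "m \<in> admissible_slopes a \<Longrightarrow> slope_defect a m > 0"
  by (simp add: slope_defect_def admissible_slopes_def)

lemma slope_defect_power2:
  "m \<in> admissible_slopes a \<Longrightarrow> (slope_defect a m)\<^sup>2 = 1 - (\<Sum>i\<in>UNIV. (a $ i)\<^sup>2 * (m $ i)\<^sup>2)"
  by (simp add: slope_defect_def admissible_slopes_def)

lemma open_admissible: "open (admissible_slopes a)"
  unfolding admissible_slopes_def by (intro open_Collect_less continuous_intros)

context
  fixes a :: "real ^ 'n"
  assumes a_pos: "\<forall>i. a $ i > 0"
begin

lemma a_nz [simp]: "a $ i \<noteq> 0"
  using a_pos by (metis less_irrefl)

lemma prod_a_pos: "(\<Prod>i\<in>UNIV. a $ i) > 0"
  using a_pos by (simp add: prod_pos)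

lemma inner_eq_scaled: "m \<bullet> x = (\<chi> i. a $ i * m $ i) \<bullet> scaled a x"
  by (simp add: inner_vec_def scaled_def)

lemma slope_defect_eq: "slope_defect a m = sqrt (1 - (norm (\<chi> i. a $ i * m $ i))\<^sup>2)"
  by (simp add: slope_defect_def norm_vec_def L2_set_def sum_nonneg power_mult_distrib)

lemma admissible_iff: "m \<in> admissible_slopes a \<longleftrightarrow> norm (\<chi> i. a $ i * m $ i) < 1"
proof -
  have "m \<in> admissible_slopes a \<longleftrightarrow> (norm (\<chi> i. a $ i * m $ i))\<^sup>2 < 1"
    by (simp add: admissible_slopes_def norm_vec_def L2_set_def sum_nonneg power_mult_distrib)
  then show ?thesis by (simp add: abs_square_less_1)
qed

text \<open>With \<open>y = scaled a x\<close>, the inequalities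
  \<open>norm y \<le> z \<le> b \<bullet> y + d\<close> and Cauchy-Schwarz give
  \<open>norm y * (1 - norm b) \<le> \<bar>d\<bar>\<close>, and \<open>norm b < 1\<close> bounds
  \<open>y\<close>. The sign of \<open>d\<close> is arbitrary, hence the absolute values.\<close>

lemma compact_cut_off:
  assumes m: "m \<in> admissible_slopes a"
  shows "compact (cut_off a m d)"
proof -
  define b where "b = (\<chi> i. a $ i * m $ i)"
  have b: "norm b < 1" using m by (simp add: admissible_iff b_def)
  have "closed {p. norm (scaled a (fst p)) \<le> snd p \<and> snd p \<le> m \<bullet> fst p + d}"
    by (intro closed_Collect_conj closed_Collect_le continuous_intros)
  also have "{p. norm (scaled a (fst p)) \<le> snd p \<and> snd p \<le> m \<bullet> fst p + d} = cut_off a m d"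
    by (auto simp: cut_off_eq)
  finally have cl: "closed (cut_off a m d)" .
  define R where "R = \<bar>d\<bar> / (1 - norm b)"
  have bound: "norm (x, z) \<le> (\<Sum>i\<in>UNIV. a $ i * R) + (norm b * R + \<bar>d\<bar>)" if "(x, z) \<in> cut_off a m d" for x z
  proof -
    have 1: "norm (scaled a x) \<le> z" and 2: "z \<le> b \<bullet> scaled a x + d"
      using that by (auto simp: cut_off_eq b_def inner_eq_scaled[of m])
    have 3: "b \<bullet> scaled a x \<le> norm b * norm (scaled a x)"
      by (rule norm_cauchy_schwarz)
    have "norm (scaled a x) * (1 - norm b) \<le> \<bar>d\<bar>"
      using 1 2 3 by (simp add: algebra_simps)
    then have R: "norm (scaled a x) \<le> R"
      using b by (simp add: R_def field_simps)
    have "\<bar>x $ i\<bar> \<le> a $ i * R" for i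
    proof -
      have "\<bar>scaled a x $ i\<bar> \<le> R"
        using R component_le_norm_cart[of "scaled a x" i] by linarith
      then show ?thesis
        using a_pos[rule_format, of i] by (simp add: scaled_def field_simps)
    qed
    then have "norm x \<le> (\<Sum>i\<in>UNIV. a $ i * R)"
      using norm_le_l1_cart[of x] by (meson order_trans sum_mono)
    moreover have "norm b * norm (scaled a x) \<le> norm b * R"
      using R by (intro mult_left_mono) auto
    then have "\<bar>z\<bar> \<le> norm b * R + \<bar>d\<bar>"
      using 1 2 3 norm_ge_zero[of "scaled a x"] by linarith
    ultimately show ?thesis
      using norm_Pair_le[of x z] by simp
  qed
  have "bounded (cut_off a m d)"
    unfolding bounded_iff using bound by (metis surj_pair)
  with cl show ?thesis by (simp add: compact_eq_bounded_closed)
qed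

text \<open>The coordinatewise substitution \<open>x = a y\<close> turns the slice into a tilted
  ball; its Jacobian is the product of the \<open>a $ i\<close>.\<close>

lemma emeasure_slice:
  assumes m: "m \<in> admissible_slopes a" and w: "w \<ge> 0"
  shows "emeasure lborel {x. norm (scaled a x) \<le> w + m \<bullet> x}
    = ennreal ((\<Prod>i\<in>UNIV. a $ i) * unit_ball_vol CARD('n) / slope_defect a m ^ (CARD('n) + 1) * w ^ CARD('n))"
proof -
  define b where "b = (\<chi> i. a $ i * m $ i)"
  have b: "norm b < 1" using m by (simp add: admissible_iff b_def)
  have cl: "closed {x. norm (scaled a x) \<le> w + m \<bullet> x}"
    by (intro closed_Collect_le continuous_intros)
  have sc: "scaled a (\<chi> i. a $ i * x $ i) = x" for x
    by (simp add: scaled_def vec_eq_iff)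
  have "(\<lambda>x. \<chi> i. 0 $ i + a $ i * x $ i) -` {x. norm (scaled a x) \<le> w + m \<bullet> x} = {y. norm y \<le> w + b \<bullet> y}"
    by (auto simp: sc inner_eq_scaled[of m] b_def)
  then have "emeasure lborel {x. norm (scaled a x) \<le> w + m \<bullet> x}
    = ennreal (\<Prod>i\<in>UNIV. a $ i) * emeasure lborel {y. norm y \<le> w + b \<bullet> y}"
    using cl a_pos by (subst emeasure_lborel_stretch_vimage[where c = "\<lambda>i. a $ i" and t = 0]) auto
  also have "\<dots> = ennreal ((\<Prod>i\<in>UNIV. a $ i) * unit_ball_vol CARD('n) / slope_defect a m ^ (CARD('n) + 1) * w ^ CARD('n))"
    using prod_a_pos w slope_defect_pos[OF m]
    by (subst emeasure_tilted_ball[OF b w]) (simp add: ennreal_mult'[symmetric] slope_defect_eq b_def mult.assoc)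
  finally show ?thesis .
qed

text \<open>Cavalieri's principle twice: over fixed \<open>x\<close> the shear only translates the
  vertical fibre, and the sheared set is then integrated over its horizontal slices.\<close>

lemma measure_cut_off:
  assumes m: "m \<in> admissible_slopes a" and d: "d \<ge> 0"
  shows "measure lebesgue (cut_off a m d) = C a (d / slope_defect a m)"
proof -
  define b where "b = (\<chi> i. a $ i * m $ i)"
  have b: "norm b < 1" using m by (simp add: admissible_iff b_def)
  define K where "K = (\<Prod>i\<in>UNIV. a $ i) * unit_ball_vol CARD('n) / slope_defect a m ^ (CARD('n) + 1)"
  have K: "K \<ge> 0" using prod_a_pos slope_defect_pos[OF m] by (simp add: K_def)
  \<comment> \<open>The sheared set. The bound \<open>0 \<le> w\<close> is implicit in it: the case
    \<open>False\<close> of \<open>layer\<close> derives it from \<open>norm b < 1\<close>.\<close>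
  define S where "S = {(x, w). norm (scaled a x) \<le> w + m \<bullet> x \<and> w \<le> d}"
  have co: "compact (cut_off a m d)" by (rule compact_cut_off[OF m])
  then have cut_meas: "cut_off a m d \<in> sets (lborel \<Otimes>\<^sub>M lborel)"
    unfolding lborel_prod by (simp add: compact_imp_closed)
  have "S = {p. norm (scaled a (fst p)) \<le> snd p + m \<bullet> fst p \<and> snd p \<le> d}"
    by (auto simp: S_def)
  also have "closed \<dots>"
    by (intro closed_Collect_conj closed_Collect_le continuous_intros)
  finally have S_meas: "S \<in> sets (lborel \<Otimes>\<^sub>M lborel)"
    unfolding lborel_prod by simp
  have slice: "emeasure lborel (Pair x -` cut_off a m d) = emeasure lborel (Pair x -` S)" for x
  proof -
    have "emeasure lborel (Pair x -` cut_off a m d) = emeasure lborel {norm (scaled a x) .. m \<bullet> x + d}"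
      by (rule arg_cong[where f = "emeasure lborel"]) (auto simp: cut_off_eq)
    \<comment> \<open>The fibre over \<open>x\<close> may be empty; then both intervals are.\<close>
    also have "\<dots> = emeasure lborel {norm (scaled a x) - m \<bullet> x .. d}"
      by (cases "norm (scaled a x) \<le> m \<bullet> x + d") (auto simp: algebra_simps)
    also have "\<dots> = emeasure lborel (Pair x -` S)"
      by (rule arg_cong[where f = "emeasure lborel"]) (auto simp: S_def)
    finally show ?thesis .
  qed
  have layer: "emeasure lborel ((\<lambda>x. (x, w)) -` S) = ennreal (K * w ^ CARD('n)) * indicator {0..d} w" for w
  proof (cases "w \<in> {0..d}")
    case True
    then have "(\<lambda>x. (x, w)) -` S = {x. norm (scaled a x) \<le> w + m \<bullet> x}"
      by (auto simp: S_def)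
    with True show ?thesis
      by (simp add: emeasure_slice[OF m] K_def)
  next
    case False
    have "w \<ge> 0" if "norm (scaled a x) \<le> w + m \<bullet> x" for x
    proof -
      have "m \<bullet> x \<le> norm b * norm (scaled a x)"
        unfolding inner_eq_scaled[of m] b_def by (rule norm_cauchy_schwarz)
      also have "\<dots> \<le> 1 * norm (scaled a x)"
        using b by (intro mult_right_mono) auto
      finally show ?thesis using that by simp
    qed
    with False have "(\<lambda>x. (x, w)) -` S = {}"
      by (auto simp: S_def)
    with False show ?thesis by simp
  qed
  have "emeasure lborel (cut_off a m d) = emeasure (lborel \<Otimes>\<^sub>M lborel) (cut_off a m d)"
    by (simp add: lborel_prod)
  also have "\<dots> = emeasure (lborel \<Otimes>\<^sub>M lborel) S"
    using cut_meas S_meas by (simp add: lborel.emeasure_pair_measure_alt slice)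
  also have "\<dots> = (\<integral>\<^sup>+w. ennreal (K * w ^ CARD('n)) * indicator {0..d} w \<partial>lborel)"
    using S_meas by (simp add: lborel_pair.emeasure_pair_measure_alt2 layer)
  \<comment> \<open>The subtracted term is the antiderivative at 0 and vanishes.\<close>
  also have "\<dots> = ennreal (K * (d ^ (CARD('n) + 1) / (CARD('n) + 1)) - K * (0 ^ (CARD('n) + 1) / (CARD('n) + 1)))"
  proof (rule nn_integral_FTC_Icc)
    show "((\<lambda>w. K * (w ^ (CARD('n) + 1) / (CARD('n) + 1))) has_field_derivative K * w ^ CARD('n)) (at w)" for w
      using DERIV_cmult[OF DERIV_cdivide[OF DERIV_pow[of "CARD('n) + 1" w UNIV]], of K "real (CARD('n) + 1)"]
      by (simp add: add.commute)
  qed (use K d in auto)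
  \<comment> \<open>The integral contributes \<open>d\<close> and the slices contribute
    \<open>1 / q\<close>, both to the power n + 1, so only \<open>d / q\<close> remains.\<close>
  also have "\<dots> = ennreal (C a (d / slope_defect a m))"
    by (simp add: C_eq K_def power_divide mult.assoc)
  finally have "emeasure lborel (cut_off a m d) = ennreal (C a (d / slope_defect a m))" .
  moreover have "C a (d / slope_defect a m) \<ge> 0"
    using prod_a_pos slope_defect_pos[OF m] d by (simp add: C_eq)
  moreover have "measure lebesgue (cut_off a m d) = measure lborel (cut_off a m d)"
    using co by (intro measure_completion) (simp add: compact_imp_closed)
  ultimately show ?thesis by (simp add: measure_def)
qed

section \<open>Inverting the volume function and solving for the intercept\<close>

lemma bij_C: "bij_betw (C a) {0..} {0..}"
proof -
  define c where "c = (\<Prod>i\<in>UNIV. a $ i) * unit_ball_vol CARD('n) / (CARD('n) + 1)"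
  have c: "c > 0" using prod_a_pos by (simp add: c_def)
  have C: "C a t = c * t ^ (CARD('n) + 1)" for t
    by (simp add: C_eq c_def)
  show ?thesis
  proof (rule bij_betw_byWitness[where f' = "\<lambda>v. root (CARD('n) + 1) (v / c)"])
    show "\<forall>t\<in>{0..}. root (CARD('n) + 1) (C a t / c) = t"
      using c by (simp add: C real_root_power_cancel del: power_Suc)
    show "\<forall>v\<in>{0..}. C a (root (CARD('n) + 1) (v / c)) = v"
      using c by (simp add: C real_root_pow_pos2 del: power_Suc)
  qed (use c in \<open>auto simp: C\<close>)
qed

lemma C_pos: "t > 0 \<Longrightarrow> C a t > 0"
  using prod_a_pos by (simp add: C_eq)

lemma C_inj: "s \<ge> 0 \<Longrightarrow> t \<ge> 0 \<Longrightarrow> C a s = C a t \<longleftrightarrow> s = t"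
  using bij_C by (auto simp: bij_betw_def inj_on_def)

text \<open>The volume depends on \<open>d\<close> only through \<open>d / q\<close>, and
  \<open>C a\<close> is injective on nonnegative reals. This gives the \<open>THE\<close> in
  \<open>intercept\<close> its meaning.\<close>

lemma cuts_volume_iff:
  assumes m: "m \<in> admissible_slopes a" and r: "r \<ge> 0"
  shows "cuts_volume a (C a r) m d \<longleftrightarrow> d = r * slope_defect a m"
proof -
  note s = slope_defect_pos[OF m]
  have "cuts_volume a (C a r) m d \<longleftrightarrow> d \<ge> 0 \<and> d / slope_defect a m = r"
    using s r by (auto simp: cuts_volume_def compact_cut_off[OF m] measure_cut_off[OF m] C_inj)
  then show ?thesis using s r by (auto simp: field_simps)
qed

lemma intercept_eq:
  assumes "m \<in> admissible_slopes a" and "r \<ge> 0"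
  shows "intercept a (C a r) m = r * slope_defect a m"
  by (simp add: intercept_def cuts_volume_iff[OF assms])

section \<open>The envelope of the constant-volume family\<close>

text \<open>Writing \<open>q\<close> for \<open>slope_defect a m\<close>, the equations of the envelope read
  \<open>x\<^sub>i = r a\<^sub>i\<^sup>2 m\<^sub>i / q\<close> and \<open>z = r / q\<close>.\<close>

lemma family_eq_derivative:
  assumes m: "m \<in> admissible_slopes a" and r: "r \<ge> 0"
  shows "((\<lambda>s. family_eq a (C a r) (x, z) (m + s *\<^sub>R axis i 1)) has_real_derivative
    r * (a $ i)\<^sup>2 * m $ i / slope_defect a m - x $ i) (at 0)"
proof -
  define P where "P = 1 - (\<Sum>j\<in>UNIV. (a $ j)\<^sup>2 * (m $ j)\<^sup>2)"
  have P: "P > 0" using m by (simp add: P_def admissible_slopes_def)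
  \<comment> \<open>The family along the axis direction in closed form; the term
    \<open>2 * s * m $ i + s\<^sup>2\<close> is the increment of
    \<open>(m $ i)\<^sup>2\<close>.\<close>
  define g where "g s = z - (m \<bullet> x + s * x $ i + r * sqrt (P - (a $ i)\<^sup>2 * (2 * s * m $ i + s\<^sup>2)))" for s
  have D: "(g has_real_derivative r * (a $ i)\<^sup>2 * m $ i / slope_defect a m - x $ i) (at 0)"
    unfolding g_def using P
    by (auto intro!: derivative_eq_intros simp: slope_defect_def P_def[symmetric] field_simps)
  have eq: "family_eq a (C a r) (x, z) (m + s *\<^sub>R axis i 1) = g s"
    if "m + s *\<^sub>R axis i 1 \<in> admissible_slopes a" for s
  proof -
    have "(\<Sum>j\<in>UNIV. (a $ j)\<^sup>2 * ((m + s *\<^sub>R axis i 1) $ j)\<^sup>2)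
        = (\<Sum>j\<in>UNIV. (a $ j)\<^sup>2 * (m $ j)\<^sup>2 + (if j = i then (a $ i)\<^sup>2 * (2 * s * m $ i + s\<^sup>2) else 0))"
      by (intro sum.cong) (auto simp: axis_def power2_eq_square algebra_simps)
    then have "slope_defect a (m + s *\<^sub>R axis i 1) = sqrt (P - (a $ i)\<^sup>2 * (2 * s * m $ i + s\<^sup>2))"
      by (simp add: slope_defect_def P_def sum.distrib sum.delta)
    moreover have "(\<Sum>j\<in>UNIV. (m + s *\<^sub>R axis i 1) $ j * x $ j) = m \<bullet> x + s * x $ i"
    proof -
      have "(\<Sum>j\<in>UNIV. (m + s *\<^sub>R axis i 1) $ j * x $ j) = (m + s *\<^sub>R axis i 1) \<bullet> x"
        by (simp only: inner_vec_def inner_real_def)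
      then show ?thesis by (simp add: inner_add_left inner_axis')
    qed
    ultimately show ?thesis
      using that r by (simp add: family_eq_def g_def intercept_eq)
  qed
  \<comment> \<open>The value of \<open>intercept\<close> is known at admissible slopes. These form
    an open set, so the closed form holds for all \<open>s\<close> near 0, which determines the
    derivative.\<close>
  have "((\<lambda>s. m + s *\<^sub>R axis i 1) \<longlongrightarrow> m + 0 *\<^sub>R axis i 1) (at 0)"
    by (intro tendsto_intros)
  then have "\<forall>\<^sub>F s in at 0. m + s *\<^sub>R axis i 1 \<in> admissible_slopes a"
    using open_admissible m by (auto elim!: topological_tendstoD)
  then have "\<forall>\<^sub>F s in nhds 0. m + s *\<^sub>R axis i 1 \<in> admissible_slopes a"
    using m by (simp add: eventually_nhds_conv_at)
  then have "\<forall>\<^sub>F s in nhds 0. family_eq a (C a r) (x, z) (m + s *\<^sub>R axis i 1) = g s"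
    by (rule eventually_mono) (rule eq)
  then show ?thesis
    using D by (subst DERIV_cong_ev[OF refl _ refl])
qed

text \<open>\<open>m\<close> is the slope of the tangent hyperplane at \<open>(x, z)\<close>, read
  off from the gradient of \<open>h a\<close>. Dividing the equation of the sheet by
  \<open>z\<^sup>2\<close> yields the defect. Both the envelope and the tangent hyperplanes rest on
  this.\<close>

lemma upper_sheet_slope:
  assumes r: "r > 0" and p: "(x, z) \<in> upper_sheet a r"
  defines "m \<equiv> \<chi> i. x $ i / ((a $ i)\<^sup>2 * z)"
  shows "m \<in> admissible_slopes a" and "slope_defect a m = r / z" and "z = m \<bullet> x + r * slope_defect a m"
proof -
  have z: "z > 0" and hz: "(\<Sum>i\<in>UNIV. (x $ i)\<^sup>2 / (a $ i)\<^sup>2) = z\<^sup>2 - r\<^sup>2"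
    using p by (auto simp: upper_sheet_def h_def)
  have "(\<Sum>i\<in>UNIV. (a $ i)\<^sup>2 * (m $ i)\<^sup>2) = (\<Sum>i\<in>UNIV. ((x $ i)\<^sup>2 / (a $ i)\<^sup>2) / z\<^sup>2)"
    using z by (intro sum.cong) (auto simp: m_def power2_eq_square field_simps)
  also have "\<dots> = (z\<^sup>2 - r\<^sup>2) / z\<^sup>2"
    unfolding sum_divide_distrib[symmetric] hz ..
  finally have Q: "1 - (\<Sum>i\<in>UNIV. (a $ i)\<^sup>2 * (m $ i)\<^sup>2) = (r / z)\<^sup>2"
    using z by (simp add: field_simps)
  show q: "slope_defect a m = r / z"
    using r z unfolding slope_defect_def Q by simp
  show "m \<in> admissible_slopes a"
    using r z unfolding admissible_slopes_def mem_Collect_eq Q by simp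
  have "m \<bullet> x = (\<Sum>i\<in>UNIV. ((x $ i)\<^sup>2 / (a $ i)\<^sup>2) / z)"
    by (simp add: inner_vec_def m_def power2_eq_square)
  also have "\<dots> = (z\<^sup>2 - r\<^sup>2) / z"
    unfolding sum_divide_distrib[symmetric] hz ..
  finally show "z = m \<bullet> x + r * slope_defect a m"
    using z by (simp add: q field_simps power2_eq_square)
qed

lemma envelope_eq:
  assumes r: "r > 0"
  shows "envelope (admissible_slopes a) (family_eq a (C a r)) = upper_sheet a r"
proof -
  have iff: "(x, z) \<in> envelope (admissible_slopes a) (family_eq a (C a r)) \<longleftrightarrow>
      (\<exists>m\<in>admissible_slopes a. z = m \<bullet> x + r * slope_defect a m \<and>
         (\<forall>i. x $ i = r * (a $ i)\<^sup>2 * m $ i / slope_defect a m))" (is "_ \<longleftrightarrow> ?R") for x z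
  proof -
    have "family_eq a (C a r) (x, z) m = 0 \<longleftrightarrow> z = m \<bullet> x + r * slope_defect a m"
      if "m \<in> admissible_slopes a" for m
      using that r by (auto simp: family_eq_def intercept_eq inner_vec_def)
    \<comment> \<open>The derivative is known and unique, so being zero is an equation for
      \<open>x $ i\<close>.\<close>
    moreover have "((\<lambda>s. family_eq a (C a r) (x, z) (m + s *\<^sub>R axis i 1)) has_real_derivative 0) (at 0)
        \<longleftrightarrow> x $ i = r * (a $ i)\<^sup>2 * m $ i / slope_defect a m" if "m \<in> admissible_slopes a" for m i
      using family_eq_derivative[OF that, of r x z i] r by (auto dest: DERIV_unique)
    ultimately show ?thesis by (auto simp: envelope_def)
  qed
  have "(x, z) \<in> upper_sheet a r \<longleftrightarrow> (\<exists>m\<in>admissible_slopes a. z = m \<bullet> x + r * slope_defect a m \<and>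
         (\<forall>i. x $ i = r * (a $ i)\<^sup>2 * m $ i / slope_defect a m))" for x z
  proof
    assume "\<exists>m\<in>admissible_slopes a. z = m \<bullet> x + r * slope_defect a m \<and>
         (\<forall>i. x $ i = r * (a $ i)\<^sup>2 * m $ i / slope_defect a m)"
    then obtain m where m: "m \<in> admissible_slopes a" and z: "z = m \<bullet> x + r * slope_defect a m"
      and x: "\<And>i. x $ i = r * (a $ i)\<^sup>2 * m $ i / slope_defect a m" by auto
    define q where "q = slope_defect a m"
    have q: "q > 0" and q2: "(\<Sum>i\<in>UNIV. (a $ i)\<^sup>2 * (m $ i)\<^sup>2) = 1 - q\<^sup>2"
      using slope_defect_pos[OF m] slope_defect_power2[OF m] by (auto simp: q_def)
    \<comment> \<open>Adding \<open>r * q\<close> to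
      \<open>m \<bullet> x = r / q * (1 - q\<^sup>2)\<close> leaves
      \<open>z = r / q\<close>.\<close>
    have "m \<bullet> x = (\<Sum>i\<in>UNIV. r / q * ((a $ i)\<^sup>2 * (m $ i)\<^sup>2))"
      by (simp add: inner_vec_def x q_def[symmetric] power2_eq_square mult_ac)
    also have "\<dots> = r / q * (1 - q\<^sup>2)" by (simp only: sum_distrib_left[symmetric] q2)
    finally have z: "z = r / q"
      using q by (simp add: z q_def[symmetric] field_simps power2_eq_square)
    have "(\<Sum>i\<in>UNIV. (x $ i)\<^sup>2 / (a $ i)\<^sup>2) = (\<Sum>i\<in>UNIV. (r / q)\<^sup>2 * ((a $ i)\<^sup>2 * (m $ i)\<^sup>2))"
      using q by (intro sum.cong) (auto simp: x q_def[symmetric] power2_eq_square field_simps)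
    also have "\<dots> = (r / q)\<^sup>2 * (1 - q\<^sup>2)" by (simp only: sum_distrib_left[symmetric] q2)
    finally show "(x, z) \<in> upper_sheet a r"
      using q r by (simp add: upper_sheet_def h_def z field_simps power2_eq_square)
  next
    assume p: "(x, z) \<in> upper_sheet a r"
    then have "z > 0" by (simp add: upper_sheet_def)
    with r show "\<exists>m\<in>admissible_slopes a. z = m \<bullet> x + r * slope_defect a m \<and>
         (\<forall>i. x $ i = r * (a $ i)\<^sup>2 * m $ i / slope_defect a m)"
      using upper_sheet_slope[OF r p]
      \<comment> \<open>The witness is the slope of the tangent hyperplane at the given
        point.\<close>
      by (intro bexI[where x = "\<chi> i. x $ i / ((a $ i)\<^sup>2 * z)"]) (simp_all add: field_simps)
  qed
  with iff show ?thesis by auto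
qed

section \<open>Tangent hyperplanes of the hyperboloid, and the conclusion\<close>

text \<open>Tangent vectors are orthogonal to the gradient, so \<open>H\<close> lies in the
  hyperplane through the point with that normal. Both are affine of dimension n, hence
  equal.\<close>

lemma tangent_hyperplane_upper_sheet:
  assumes k: "k > 0" and H: "tangent_hyperplane (upper_sheet a k) H"
  obtains m where "m \<in> admissible_slopes a" and "H = graph_hyperplane m (k * slope_defect a m)"
proof -
  obtain x z where p: "(x, z) \<in> upper_sheet a k" and Heq: "H = (\<lambda>v. (x, z) + v) ` tangent_vectors (upper_sheet a k) (x, z)"
    and aff: "affine H" "aff_dim H = int (DIM((real ^ 'n) \<times> real)) - 1"
    using H by (auto simp: tangent_hyperplane_def is_hyperplane_def)
  define m where "m = (\<chi> i. x $ i / ((a $ i)\<^sup>2 * z))"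
  note m = upper_sheet_slope[OF k p, folded m_def]
  have z: "z > 0" using p by (simp add: upper_sheet_def)
  have "grad_h a (x, z) = (2 * z) *\<^sub>R (- m, 1)"
    using z by (simp add: grad_h_def m_def vec_eq_iff)
  then have "(- m, 1) \<bullet> v = 0" if "v \<in> tangent_vectors (upper_sheet a k) (x, z)" for v
    using tangent_vectors_upper_sheet[OF that] z by (simp del: scaleR_Pair)
  then have "H \<subseteq> {q. (- m, 1) \<bullet> q = k * slope_defect a m}"
    using m(3) by (auto simp: Heq inner_add_right)
  \<comment> \<open>The empty set has \<open>aff_dim\<close> -1, whereas \<open>H\<close> has
    dimension n.\<close>
  moreover have "H \<noteq> {}"
    using aff by auto
  moreover have nz: "(- m, 1 :: real) \<noteq> 0"
    by (simp add: zero_prod_def)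
  ultimately have "H = graph_hyperplane m (k * slope_defect a m)"
    unfolding graph_hyperplane_eq using aff aff_dim_hyperplane[OF nz]
    by (intro affine_dim_equal affine_hyperplane) auto
  with m(1) show ?thesis by (rule that)
qed

end

theorem theorem5:
  fixes a :: "real ^ 'n" and k V :: real
  assumes "\<forall>i. a $ i > 0" and "k > 0" and "V > 0"
  shows "(\<forall>H. tangent_hyperplane (upper_sheet a k) H \<longrightarrow>
            (\<exists>m d. H = graph_hyperplane m d \<and>
               compact (cut_off a m d) \<and>
               aff_dim (cut_off a m d) = int (CARD('n) + 1) \<and>
               measure lebesgue (cut_off a m d) = C a k)) \<and>
         bij_betw (C a) {0..} {0..} \<and>
         (\<forall>m\<in>admissible_slopes a. \<exists>!d. cuts_volume a V m d) \<and>
         (let r = the_inv_into {0..} (C a) V;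
              E = envelope (admissible_slopes a) (family_eq a V)
          in r > 0 \<and> C a r = V \<and> C2_hypersurface E \<and> E = upper_sheet a r)"
proof -
  note a = assms(1) and k = assms(2) and V = assms(3)
  define r where "r = the_inv_into {0..} (C a) V"
  note bij = bij_C[OF a]
  have inj: "inj_on (C a) {0..}" and V_im: "V \<in> C a ` {0..}"
    using bij V by (auto simp: bij_betw_def)
  have Cr: "C a r = V" and "r \<ge> 0"
    using f_the_inv_into_f[OF inj V_im] the_inv_into_into[OF inj V_im order_refl] by (auto simp: r_def)
  \<comment> \<open>\<open>V > 0\<close> therefore excludes \<open>r = 0\<close>.\<close>
  moreover have "C a 0 = 0" by (simp add: C_eq)
  ultimately have r: "r > 0" using V by (cases "r = 0") auto
  have "\<exists>m d. H = graph_hyperplane m d \<and> compact (cut_off a m d) \<and>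
      aff_dim (cut_off a m d) = int (CARD('n) + 1) \<and> measure lebesgue (cut_off a m d) = C a k"
    if H: "tangent_hyperplane (upper_sheet a k) H" for H
  proof -
    obtain m where m: "m \<in> admissible_slopes a" and H: "H = graph_hyperplane m (k * slope_defect a m)"
      using tangent_hyperplane_upper_sheet[OF a k H] .
    \<comment> \<open>With \<open>d = k * q\<close> the ratio \<open>d / q\<close> is
      \<open>k\<close> for every slope, so the volume is constant.\<close>
    have vol: "measure lebesgue (cut_off a m (k * slope_defect a m)) = C a k"
      using measure_cut_off[OF a m] slope_defect_pos[OF m] k by simp
    then have "aff_dim (cut_off a m (k * slope_defect a m)) = int (CARD('n) + 1)"
      using aff_dim_measure_pos[of "cut_off a m (k * slope_defect a m)"] C_pos[OF a k] by simp
    with H vol compact_cut_off[OF a m] show ?thesis by blast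
  qed
  moreover have "\<exists>!d. cuts_volume a V m d" if "m \<in> admissible_slopes a" for m
    using cuts_volume_iff[OF a that, of r] r by (simp add: Cr)
  moreover have "envelope (admissible_slopes a) (family_eq a V) = upper_sheet a r"
    using envelope_eq[OF a r] by (simp add: Cr)
  ultimately show ?thesis
    using bij r Cr C2_upper_sheet by (simp add: Let_def r_def)
qed

end
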